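(* Let $G$ be a connected graph on $n\ge 3$ vertices. Then $Z_{(1)}(G)=n-1$ if and only if $G$ is isomorphic to one of $K_n$, $S_n$, $K_{n-1}+v^{*}$, $K_n-e$.
   Context: All graphs are finite, simple and undirected. Let $G$ be a graph, $S\subseteq V(G)$ a set of initially blue vertices (all other vertices white), and $L\subseteq V(G)$ a set of leaks. The leaky color change rule: a blue vertex $b\notin L$ which has exactly one white neighbor $w$ may force $w$ to become blue. $S$ is an $\ell$-leaky forcing set if for every choice of a set $L$ of $\ell$ leaks, repeated application of the rule eventually turns all vertices blue. $Z_{(\ell)}(G)$ is the minimum size of an $\ell$-leaky forcing set of $G$. $K_n$ is the complete graph on $n$ vertices; $S_n$ is the star graph on $n$ vertices in total (one center adjacent to $n-1$ leaves); $K_{n-1}+v^{*}$ is the complete graph on $n-1$ vertices together with one added leaf $v^{*}$ (a new vertex adjacent to exactly one vertex of $K_{n-1}$); $K_n-e$ is the complete graph on $n$ vertices with one edge removed. *)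

theory Defs
  imports "Graph_Theory.Pair_Digraph" "Graph_Theory.Digraph_Isomorphism"
begin

text \<open>
  A finite simple undirected graph is a \<^locale>\<open>pair_graph\<close>: a finite, loop-free, symmetric
  set of arcs, the edge \<open>uv\<close> being represented by the two arcs \<open>(u, v)\<close> and \<open>(v, u)\<close>.
\<close>

section \<open>Leaky forcing\<close>

text \<open>One application of the rule, as a step between sets of blue vertices.\<close>

definition leaky_force :: "'a pair_pre_digraph \<Rightarrow> 'a set \<Rightarrow> 'a set \<Rightarrow> 'a set \<Rightarrow> bool" where
  "leaky_force G L B B' \<longleftrightarrow>
     (\<exists>b w. b \<in> B \<and> b \<notin> L \<and> {u. (b, u) \<in> parcs G \<and> u \<notin> B} = {w} \<and> B' = insert w B)"

text \<open>
  A possible force stays possible, or its target has turned blue, after any other force. So if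
  one sequence of forces reaches the whole vertex set, then every maximal sequence does.
\<close>

definition leaky_forcing_set :: "'a pair_pre_digraph \<Rightarrow> nat \<Rightarrow> 'a set \<Rightarrow> bool" where
  "leaky_forcing_set G l S \<longleftrightarrow>
     S \<subseteq> pverts G \<and>
     (\<forall>L. L \<subseteq> pverts G \<and> card L = l \<longrightarrow> (leaky_force G L)\<^sup>*\<^sup>* S (pverts G))"

definition leaky_forcing_number :: "nat \<Rightarrow> 'a pair_pre_digraph \<Rightarrow> nat" where
  "leaky_forcing_number l G = (LEAST k. \<exists>S. leaky_forcing_set G l S \<and> card S = k)"

lemma leaky_forcing_set_pverts: "leaky_forcing_set G l (pverts G)"
  by (simp add: leaky_forcing_set_def)

lemma leaky_forcing_number_attained:
  "\<exists>S. leaky_forcing_set G l S \<and> card S = leaky_forcing_number l G"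
  unfolding leaky_forcing_number_def
  by (rule LeastI_ex) (use leaky_forcing_set_pverts in blast)

lemma leaky_forcing_number_le:
  "leaky_forcing_set G l S \<Longrightarrow> leaky_forcing_number l G \<le> card S"
  unfolding leaky_forcing_number_def by (rule Least_le) blast

section \<open>The extremal graphs\<close>

definition complete_graph :: "nat \<Rightarrow> nat pair_pre_digraph" where
  "complete_graph n = \<lparr>pverts = {..<n}, parcs = {(u, v). u < n \<and> v < n \<and> u \<noteq> v}\<rparr>"

text \<open>The centre is \<open>0\<close>, and \<open>n\<close> counts the centre.\<close>

definition star_graph :: "nat \<Rightarrow> nat pair_pre_digraph" where
  "star_graph n = \<lparr>pverts = {..<n}, parcs = {0} \<times> {1..<n} \<union> {1..<n} \<times> {0}\<rparr>"

text \<open>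
  \<open>K\<^sub>m + v\<^sup>*\<close> for \<open>m \<ge> 1\<close>, with \<open>v\<^sup>* = m\<close> attached to the vertex \<open>0\<close> of \<open>K\<^sub>m\<close>. Since
  \<open>K\<^sub>m\<close> is vertex-transitive, any other vertex gives an isomorphic graph.
\<close>

definition complete_graph_plus_leaf :: "nat \<Rightarrow> nat pair_pre_digraph" where
  "complete_graph_plus_leaf m =
     \<lparr>pverts = insert m (pverts (complete_graph m)),
      parcs = parcs (complete_graph m) \<union> {(0, m), (m, 0)}\<rparr>"

text \<open>
  \<open>K\<^sub>n - e\<close> for \<open>n \<ge> 2\<close>, with \<open>e\<close> the edge between \<open>0\<close> and \<open>1\<close>. Since \<open>K\<^sub>n\<close> is
  edge-transitive, removing any other edge gives an isomorphic graph.
\<close>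

definition complete_graph_minus_edge :: "nat \<Rightarrow> nat pair_pre_digraph" where
  "complete_graph_minus_edge n =
     \<lparr>pverts = pverts (complete_graph n),
      parcs = parcs (complete_graph n) - {(0, 1), (1, 0)}\<rparr>"

lemma finite_complete_graph_arcs: "finite {(u, v). u < (n::nat) \<and> v < n \<and> u \<noteq> v}"
  by (rule finite_subset[of _ "{..<n} \<times> {..<n}"]) auto

lemma pair_graph_complete_graph: "pair_graph (complete_graph n)"
  by unfold_locales
    (auto simp: complete_graph_def symmetric_def sym_def finite_complete_graph_arcs)

lemma pair_graph_star_graph: "pair_graph (star_graph n)"
  by unfold_locales (auto simp: star_graph_def symmetric_def sym_def)

lemma pair_graph_complete_graph_plus_leaf:
  "m \<ge> 1 \<Longrightarrow> pair_graph (complete_graph_plus_leaf m)"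
  by unfold_locales
    (auto simp: complete_graph_plus_leaf_def complete_graph_def symmetric_def sym_def
      finite_complete_graph_arcs)

lemma pair_graph_complete_graph_minus_edge: "pair_graph (complete_graph_minus_edge n)"
  by unfold_locales
    (auto simp: complete_graph_minus_edge_def complete_graph_def symmetric_def sym_def
      finite_complete_graph_arcs)

definition graph_iso :: "'a pair_pre_digraph \<Rightarrow> 'b pair_pre_digraph \<Rightarrow> bool" where
  "graph_iso G H \<longleftrightarrow> digraph_iso (with_proj G) (with_proj H)"

end

theory Submission
  imports Defs
begin

text \<open>
  Supersets of leaky forcing sets are leaky forcing, so below the full vertex set only the
  complements of one or two vertices matter. In a connected graph with at least three vertices some
  vertex \<open>v\<close> has degree at least two; one leak cannot spoil all neighbours of \<open>v\<close>, so the complement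
  of \<open>{v}\<close> is 1-leaky forcing and the number is at most \<open>n - 1\<close>. It equals \<open>n - 1\<close> exactly when no
  complement of a pair \<open>{x, y}\<close> works. Such a complement works if and only if \<open>x\<close> and \<open>y\<close> both have
  degree at least two and at least two further vertices are adjacent to exactly one of \<open>x\<close>, \<open>y\<close>
  (\<open>leaky_forcing_set_minus_two_iff\<close>): only such vertices can make the first force, and one leak
  stops one of them. Hence the number is \<open>n - 1\<close> if and only if any two vertices of degree at least
  two are near twins, that is, at most one other vertex distinguishes their neighbourhoods
  (\<open>leaky_forcing_number_one_eq_iff\<close>). This condition no longer mentions forcing.

  The four families satisfy it by inspection. Conversely, assume it holds. If two nonadjacent
  vertices \<open>a\<close>, \<open>c\<close> of degree at least two have a common neighbour \<open>m\<close>, then \<open>c\<close> is the one vertex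
  that distinguishes \<open>a\<close> from \<open>m\<close>, and \<open>a\<close> the one that distinguishes \<open>c\<close> from \<open>m\<close>; so all other
  vertices are adjacent to all or none of \<open>a\<close>, \<open>m\<close>, \<open>c\<close>. By connectedness it is all of them, for every
  such \<open>m\<close>, and the graph is complete except for the edge \<open>ac\<close>
  (\<open>induced_path_imp_complete_minus_edge\<close>). Otherwise the vertices of degree at least two form
  a clique (\<open>nonpendant_vertices_adjacent\<close>), and every other vertex is a leaf attached to the clique.
  If the clique is a single vertex, the graph is a star. If it is larger, two leaves
  would distinguish some pair of its vertices, so there is at most one leaf, and the graph is
  \<open>K\<^sub>n\<close> or \<open>K\<^sub>n\<^sub>-\<^sub>1\<close> with a leaf.
\<close>

section \<open>Degrees and near twins\<close>

context pair_pre_digraph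
begin

definition nbrs :: "'a \<Rightarrow> 'a set" where
  "nbrs v = {u. (v, u) \<in> parcs G}"

text \<open>
  In a simple graph this is degree at least two, phrased for its use: no single leak \<open>l\<close> can
  prevent all neighbours of \<open>v\<close> from forcing it.
\<close>

definition nonpendant :: "'a \<Rightarrow> bool" where
  "nonpendant v \<longleftrightarrow> \<not> (\<exists>l. nbrs v \<subseteq> {l})"

text \<open>
  With \<open>x\<close> and \<open>y\<close> themselves left out, adjacent and nonadjacent pairs are treated alike. Here
  \<open>l\<close> plays the role of a leak that stops every first force when exactly \<open>x\<close> and \<open>y\<close> are white.
\<close>

definition near_twins :: "'a \<Rightarrow> 'a \<Rightarrow> bool" where
  "near_twins x y \<longleftrightarrow> (\<exists>l. \<forall>z. z \<noteq> x \<and> z \<noteq> y \<and> (z \<in> nbrs x) \<noteq> (z \<in> nbrs y) \<longrightarrow> z = l)"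

end

section \<open>One leak\<close>

text \<open>
  Every force starting from \<open>S\<close> is still possible from a larger set, unless its target is
  already blue there.
\<close>

lemma leaky_force_superset:
  assumes "(leaky_force G L)\<^sup>*\<^sup>* S B" "S \<subseteq> T"
  shows "\<exists>D. B \<subseteq> D \<and> (leaky_force G L)\<^sup>*\<^sup>* T D"
  using assms(1)
proof (induction rule: rtranclp_induct)
  case base
  then show ?case using assms(2) by blast
next
  case (step B B')
  then obtain D where D: "B \<subseteq> D" "(leaky_force G L)\<^sup>*\<^sup>* T D" by blast
  from step(2) obtain b w where bw: "b \<in> B" "b \<notin> L"
    "{u. (b, u) \<in> parcs G \<and> u \<notin> B} = {w}" "B' = insert w B"
    unfolding leaky_force_def by blast
  show ?case
  proof (cases "w \<in> D")
    case True
    then show ?thesis using D bw(4) by blast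
  next
    case False
    then have "{u. (b, u) \<in> parcs G \<and> u \<notin> D} = {w}" using bw(3) D(1) by blast
    then have "leaky_force G L D (insert w D)"
      unfolding leaky_force_def using bw(1,2) D(1) by blast
    then have "(leaky_force G L)\<^sup>*\<^sup>* T (insert w D)" using D(2) by (rule rtranclp.rtrancl_into_rtrancl[rotated])
    then show ?thesis using D(1) bw(4) by blast
  qed
qed

context pair_graph
begin

lemma nbrs_sym: "u \<in> nbrs v \<longleftrightarrow> v \<in> nbrs u"
  by (auto simp: nbrs_def dest: arcs_symmetric)

lemma nbrs_irrefl [simp]: "v \<notin> nbrs v"
  by (auto simp: nbrs_def dest: no_loops')

lemma nbrs_subset: "nbrs v \<subseteq> pverts G"
  by (auto simp: nbrs_def dest: in_arcsD2)

lemma leaky_forceI: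
  assumes "b \<in> B" "b \<notin> L" "w \<in> nbrs b" "w \<notin> B" "nbrs b \<subseteq> insert w B"
  shows "leaky_force G L B (insert w B)"
proof -
  have "{u. (b, u) \<in> parcs G \<and> u \<notin> B} = {w}"
    using assms(3-5) by (auto simp: nbrs_def)
  then show ?thesis unfolding leaky_force_def using assms(1,2) by blast
qed

lemma leaky_force_within:
  assumes "(leaky_force G L)\<^sup>*\<^sup>* S B" "S \<subseteq> pverts G"
  shows "B \<subseteq> pverts G"
  using assms(1)
proof (induction rule: rtranclp_induct)
  case base
  then show ?case by (rule assms(2))
next
  case (step B B')
  then show ?case unfolding leaky_force_def by (blast dest: in_arcsD2)
qed

lemma leaky_forcing_set_superset:
  assumes "leaky_forcing_set G l S" "S \<subseteq> T" "T \<subseteq> pverts G"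
  shows "leaky_forcing_set G l T"
  unfolding leaky_forcing_set_def
proof (intro conjI allI impI)
  fix L assume "L \<subseteq> pverts G \<and> card L = l"
  then have "(leaky_force G L)\<^sup>*\<^sup>* S (pverts G)"
    using assms(1) by (auto simp: leaky_forcing_set_def)
  then obtain D where D: "pverts G \<subseteq> D" "(leaky_force G L)\<^sup>*\<^sup>* T D"
    using leaky_force_superset[OF _ assms(2)] by blast
  then have "D = pverts G" using leaky_force_within[OF D(2) assms(3)] by (intro equalityI)
  then show "(leaky_force G L)\<^sup>*\<^sup>* T (pverts G)" using D(2) by simp
qed (rule assms(3))

text \<open>
  Only a neighbour can force a vertex, so a white vertex all of whose neighbours leak stays
  white.
\<close>

lemma leaks_around_vertex_block:
  assumes "(leaky_force G L)\<^sup>*\<^sup>* S B" "x \<notin> S" "nbrs x \<subseteq> L"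
  shows "x \<notin> B"
  using assms(1)
proof (induction rule: rtranclp_induct)
  case base
  then show ?case by (rule assms(2))
next
  case (step B B')
  then obtain b w where bw: "b \<notin> L" "{u. (b, u) \<in> parcs G \<and> u \<notin> B} = {w}" "B' = insert w B"
    unfolding leaky_force_def by blast
  then have "w \<in> nbrs b" by (auto simp: nbrs_def)
  then have "w \<noteq> x" using nbrs_sym bw(1) assms(3) by blast
  then show ?case using step.IH bw(3) by blast
qed

text \<open>
  Leaks must be vertices of the graph, whereas the \<open>l\<close> that bounds a neighbourhood in
  \<open>nonpendant\<close>, or the distinguishing vertices in \<open>near_twins\<close>, is an arbitrary element of the type.
\<close>

lemma subset_singleton_vertex:
  assumes "X \<subseteq> {l}" "X \<subseteq> pverts G" "v \<in> pverts G"
  obtains l' where "l' \<in> pverts G" "X \<subseteq> {l'}"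
  using assms by (cases "X = {}") auto

lemma last_vertex_forced:
  assumes "x \<in> pverts G" "nonpendant x"
  shows "leaky_force G {l} (pverts G - {x}) (pverts G)"
proof -
  obtain b where b: "b \<in> nbrs x" "b \<noteq> l"
    using assms(2) by (auto simp: nonpendant_def)
  then have "b \<in> pverts G - {x}" using nbrs_subset by auto
  then have "leaky_force G {l} (pverts G - {x}) (insert x (pverts G - {x}))"
    using b nbrs_sym nbrs_subset by (intro leaky_forceI[of b]) auto
  then show ?thesis using assms(1) by (simp add: insert_absorb)
qed

lemma leaky_forcing_set_minus_one:
  assumes "x \<in> pverts G" "nonpendant x"
  shows "leaky_forcing_set G 1 (pverts G - {x})"
  using last_vertex_forced[OF assms]
  by (auto simp: leaky_forcing_set_def card_1_singleton_iff)

text \<open>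
  A blue vertex forces at the start exactly when it is adjacent to one of the two white
  vertices but not to the other, and a single leak stops all such vertices only if there is at most
  one of them. The second white vertex then needs a neighbour that does not leak.
\<close>

lemma leaky_forcing_set_minus_two_iff:
  assumes xy: "x \<in> pverts G" "y \<in> pverts G" "x \<noteq> y"
  shows "leaky_forcing_set G 1 (pverts G - {x, y}) \<longleftrightarrow>
    nonpendant x \<and> nonpendant y \<and> \<not> near_twins x y"
proof
  let ?S = "pverts G - {x, y}"
  assume forcing: "leaky_forcing_set G 1 ?S"
  have force: "(leaky_force G {l})\<^sup>*\<^sup>* ?S (pverts G)" if "l \<in> pverts G" for l
    using forcing that by (auto simp: leaky_forcing_set_def)
  have nonpendant: "nonpendant v" if v: "v \<in> {x, y}" for v
  proof (rule ccontr)
    assume "\<not> nonpendant v"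
    then obtain l0 where "nbrs v \<subseteq> {l0}" unfolding nonpendant_def by blast
    then obtain l where "l \<in> pverts G" "nbrs v \<subseteq> {l}"
      by (rule subset_singleton_vertex[OF _ nbrs_subset xy(1)])
    then show False
      using leaks_around_vertex_block[OF force, of l v] v xy by blast
  qed
  have "\<not> near_twins x y"
  proof
    let ?X = "{z. z \<noteq> x \<and> z \<noteq> y \<and> (z \<in> nbrs x) \<noteq> (z \<in> nbrs y)}"
    assume "near_twins x y"
    then obtain l0 where "?X \<subseteq> {l0}" unfolding near_twins_def by blast
    moreover have "?X \<subseteq> pverts G" using nbrs_subset by blast
    ultimately obtain l where l: "l \<in> pverts G" "?X \<subseteq> {l}"
      by (rule subset_singleton_vertex[OF _ _ xy(1)])
    \<comment> \<open>With the leak \<open>l\<close> the process is stuck from the start.\<close>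
    have no_force: "\<not> leaky_force G {l} ?S B" for B
    proof
      assume "leaky_force G {l} ?S B"
      then obtain b w where b: "b \<in> ?S" "b \<noteq> l" "{u. (b, u) \<in> parcs G \<and> u \<notin> ?S} = {w}"
        unfolding leaky_force_def by blast
      have "u \<in> nbrs b \<and> u \<notin> ?S \<longleftrightarrow> u = w" for u
        using b(3) by (simp add: nbrs_def set_eq_iff)
      then have white: "u \<in> nbrs b \<and> (u = x \<or> u = y) \<longleftrightarrow> u = w" for u
        using subsetD[OF nbrs_subset, of u b] xy(1,2) by (metis Diff_iff insert_iff empty_iff)
      have "(x \<in> nbrs b) \<noteq> (y \<in> nbrs b)"
        using white[of x] white[of y] white[of w] xy(3) by metis
      then have "(b \<in> nbrs x) \<noteq> (b \<in> nbrs y)"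
        unfolding nbrs_sym[of x b] nbrs_sym[of y b] .
      then have "b \<in> ?X" using b(1) by simp
      then show False using l(2) b(2) by blast
    qed
    have "(leaky_force G {l})\<^sup>*\<^sup>* ?S (pverts G)" by (rule force[OF l(1)])
    then have "?S = pverts G"
      by (cases rule: converse_rtranclpE) (use no_force in auto)
    then show False using xy(1) by blast
  qed
  with nonpendant show "nonpendant x \<and> nonpendant y \<and> \<not> near_twins x y" by blast
next
  assume asm: "nonpendant x \<and> nonpendant y \<and> \<not> near_twins x y"
  \<comment> \<open>\<open>z\<close> forces \<open>u\<close>; then some neighbour of \<open>v\<close> other than \<open>l\<close>, possibly \<open>u\<close>, forces \<open>v\<close>.\<close>
  have two_steps: "(leaky_force G {l})\<^sup>*\<^sup>* (pverts G - {u, v}) (pverts G)"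
    if uv: "u \<in> pverts G" "v \<in> pverts G" "u \<noteq> v" "nonpendant v"
      and z: "z \<noteq> u" "z \<noteq> v" "z \<in> nbrs u" "z \<notin> nbrs v" "z \<noteq> l" for u v z l
  proof -
    have "leaky_force G {l} (pverts G - {u, v}) (insert u (pverts G - {u, v}))"
      using uv z nbrs_sym nbrs_subset by (intro leaky_forceI[of z]) auto
    moreover have "insert u (pverts G - {u, v}) = pverts G - {v}" using uv by blast
    ultimately have "leaky_force G {l} (pverts G - {u, v}) (pverts G - {v})" by simp
    then show ?thesis
      using last_vertex_forced[OF uv(2,4)] by (meson converse_rtranclp_into_rtranclp r_into_rtranclp)
  qed
  have "(leaky_force G {l})\<^sup>*\<^sup>* (pverts G - {x, y}) (pverts G)" for l
  proof -
    obtain z where z: "z \<noteq> x" "z \<noteq> y" "(z \<in> nbrs x) \<noteq> (z \<in> nbrs y)" "z \<noteq> l"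
      using asm unfolding near_twins_def by blast
    show ?thesis
    proof (cases "z \<in> nbrs x")
      case True
      then show ?thesis using two_steps[of x y z l] z xy asm by blast
    next
      case False
      then have "(leaky_force G {l})\<^sup>*\<^sup>* (pverts G - {y, x}) (pverts G)"
        using two_steps[of y x z l] z xy asm by blast
      then show ?thesis by (simp add: insert_commute)
    qed
  qed
  then show "leaky_forcing_set G 1 (pverts G - {x, y})"
    by (auto simp: leaky_forcing_set_def card_1_singleton_iff)
qed

text \<open>
  A leaky forcing set with at most \<open>n - 2\<close> elements could be enlarged to one that misses exactly
  two vertices. The nonpendant vertex \<open>v\<close> gives the upper bound.
\<close>

lemma leaky_forcing_number_one_eq_iff:
  assumes "card (pverts G) = n" "n \<ge> 2" "v \<in> pverts G" "nonpendant v"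
  shows "leaky_forcing_number 1 G = n - 1 \<longleftrightarrow>
    (\<forall>x\<in>pverts G. \<forall>y\<in>pverts G. x \<noteq> y \<and> nonpendant x \<and> nonpendant y \<longrightarrow> near_twins x y)"
    (is "?Z = _ \<longleftrightarrow> ?twins")
proof
  assume Z: "?Z = n - 1"
  show ?twins
  proof (intro ballI impI, rule ccontr)
    fix x y assume xy: "x \<in> pverts G" "y \<in> pverts G" "x \<noteq> y \<and> nonpendant x \<and> nonpendant y"
      and "\<not> near_twins x y"
    then have "leaky_forcing_set G 1 (pverts G - {x, y})"
      using leaky_forcing_set_minus_two_iff by blast
    then have "?Z \<le> card (pverts G - {x, y})" by (rule leaky_forcing_number_le)
    also have "\<dots> = n - 2" using xy assms(1) by (simp add: card_Diff_subset)
    finally show False using Z assms(2) by linarith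
  qed
next
  assume twins: ?twins
  have "?Z \<le> card (pverts G - {v})"
    by (rule leaky_forcing_number_le[OF leaky_forcing_set_minus_one[OF assms(3,4)]])
  then have le: "?Z \<le> n - 1" using assms by simp
  obtain S where S: "leaky_forcing_set G 1 S" "card S = ?Z"
    using leaky_forcing_number_attained by blast
  have sub: "S \<subseteq> pverts G" using S(1) by (simp add: leaky_forcing_set_def)
  have "\<not> ?Z < n - 1"
  proof
    assume "?Z < n - 1"
    then have "card (pverts G - S) \<ge> 2"
      using S(2) sub assms(1) by (simp add: card_Diff_subset finite_subset[OF sub pair_finite_verts])
    then obtain X where "X \<subseteq> pverts G - S" "card X = 2"
      by (meson obtain_subset_with_card_n)
    then obtain x y where xy: "x \<noteq> y" "x \<in> pverts G - S" "y \<in> pverts G - S"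
      by (auto simp: card_2_iff)
    then have "leaky_forcing_set G 1 (pverts G - {x, y})"
      using sub by (intro leaky_forcing_set_superset[OF S(1)]) auto
    then show False using leaky_forcing_set_minus_two_iff twins xy by blast
  qed
  with le show "?Z = n - 1" by linarith
qed

end

section \<open>Isomorphism with the extremal graphs\<close>

text \<open>
  Between graphs whose arcs are pairs of vertices, the arc map of an isomorphism is determined by
  its vertex map.
\<close>

lemma graph_iso_iff:
  assumes "pair_graph G" "pair_graph H"
  shows "graph_iso G H \<longleftrightarrow> (\<exists>f. bij_betw f (pverts G) (pverts H) \<and>
    (\<forall>u\<in>pverts G. \<forall>v\<in>pverts G. (u, v) \<in> parcs G \<longleftrightarrow> (f u, f v) \<in> parcs H))"
    (is "_ \<longleftrightarrow> (\<exists>f. ?iso f)")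
proof -
  interpret G: pair_graph G by fact
  interpret H: pair_graph H by fact
  show ?thesis
  proof
    assume "graph_iso G H"
    then obtain h where h: "pre_digraph.digraph_isomorphism (with_proj G) h"
      and H: "with_proj H = app_iso h (with_proj G)"
      unfolding graph_iso_def digraph_iso_def by blast
    let ?f = "iso_verts h"
    have verts: "pverts H = ?f ` pverts G" and arcs: "parcs H = iso_arcs h ` parcs G"
      and tail: "fst = iso_tail h" and head: "snd = iso_head h"
      using arg_cong[OF H, of verts] arg_cong[OF H, of arcs]
        arg_cong[OF H, of tail] arg_cong[OF H, of head] by simp_all
    have inj: "inj_on ?f (pverts G)"
      using h by (simp add: pre_digraph.digraph_isomorphism_def)
    have "iso_arcs h a = (?f (fst a), ?f (snd a))" if "a \<in> parcs G" for a
      using h that by (simp add: pre_digraph.digraph_isomorphism_def prod_eq_iff flip: tail head)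
    then have arcs': "parcs H = (\<lambda>a. (?f (fst a), ?f (snd a))) ` parcs G"
      using arcs by simp
    have "?iso ?f"
    proof (intro conjI ballI)
      show "bij_betw ?f (pverts G) (pverts H)" using inj verts by (simp add: bij_betw_def)
      fix u v assume uv: "u \<in> pverts G" "v \<in> pverts G"
      show "(u, v) \<in> parcs G \<longleftrightarrow> (?f u, ?f v) \<in> parcs H"
      proof
        assume "(?f u, ?f v) \<in> parcs H"
        then obtain u' v' where "(u', v') \<in> parcs G" "?f u = ?f u'" "?f v = ?f v'"
          by (auto simp: arcs')
        then show "(u, v) \<in> parcs G"
          using inj_onD[OF inj] uv G.in_arcsD1 G.in_arcsD2 by metis
      qed (force simp: arcs')
    qed
    then show "\<exists>f. ?iso f" by (rule exI[of _ ?f])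
  next
    assume "\<exists>f. ?iso f"
    then obtain f where f: "bij_betw f (pverts G) (pverts H)"
      and arcs: "\<And>u v. u \<in> pverts G \<Longrightarrow> v \<in> pverts G \<Longrightarrow>
        (u, v) \<in> parcs G \<longleftrightarrow> (f u, f v) \<in> parcs H" by blast
    from f have inj: "inj_on f (pverts G)" and img: "f ` pverts G = pverts H"
      by (auto simp: bij_betw_def)
    define h where "h = \<lparr>iso_verts = f, iso_arcs = map_prod f f,
      iso_head = (snd :: 'b \<times> 'b \<Rightarrow> 'b), iso_tail = fst\<rparr>"
    have "inj_on (map_prod f f) (parcs G)"
      by (rule inj_on_subset[OF map_prod_inj_on[OF inj inj]])
        (auto dest: G.in_arcsD1 G.in_arcsD2)
    then have "pre_digraph.digraph_isomorphism (with_proj G) h"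
      unfolding pre_digraph.digraph_isomorphism_def h_def
      using inj G.wf_digraph_axioms by simp
    moreover have "map_prod f f ` parcs G = parcs H"
    proof (intro equalityI subsetI)
      fix a assume "a \<in> map_prod f f ` parcs G"
      then show "a \<in> parcs H" using arcs by (auto dest: G.in_arcsD1 G.in_arcsD2)
    next
      fix a assume a: "a \<in> parcs H"
      obtain u' v' where "a = (u', v')" by (cases a)
      moreover from this a have "u' \<in> f ` pverts G" "v' \<in> f ` pverts G"
        by (auto simp: img dest: H.in_arcsD1 H.in_arcsD2)
      ultimately show "a \<in> map_prod f f ` parcs G" using a arcs by force
    qed
    then have "with_proj H = app_iso h (with_proj G)"
      by (simp add: app_iso_def with_proj_def h_def img)
    ultimately show "graph_iso G H"
      unfolding graph_iso_def digraph_iso_def by blast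
  qed
qed

text \<open>
  Each extremal graph other than \<open>K\<^sub>n\<close> is described by at most two special vertices, so an isomorphism
  onto it is any bijection that puts these at the right places.
\<close>

lemma bij_betw_two_prescribed:
  assumes "finite V" "card V = n" "a \<in> V" "b \<in> V" "a \<noteq> b" "i < n" "j < n" "i \<noteq> j"
  obtains f where "bij_betw f V {..<n}" "f a = i" "f b = j"
proof -
  have "card (V - {a, b}) = card ({..<n} - {i, j})"
    using assms by (simp add: card_Diff_subset)
  then obtain g where g: "bij_betw g (V - {a, b}) ({..<n} - {i, j})"
    using assms(1) finite_same_card_bij by (metis finite_Diff finite_lessThan)
  define f where "f = g(a := i, b := j)"
  have fab: "f a = i" "f b = j" using assms(5) by (simp_all add: f_def)
  have "bij_betw f (V - {a, b}) ({..<n} - {i, j})"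
    by (rule iffD1[OF bij_betw_cong g]) (simp add: f_def)
  moreover have "bij_betw f {a, b} {i, j}"
    using fab assms(5,8) by (auto simp: bij_betw_def inj_on_def)
  ultimately have "bij_betw f (V - {a, b} \<union> {a, b}) ({..<n} - {i, j} \<union> {i, j})"
    by (rule bij_betw_combine) blast
  moreover have "V - {a, b} \<union> {a, b} = V" "{..<n} - {i, j} \<union> {i, j} = {..<n}"
    using assms by auto
  ultimately show thesis using that fab by simp
qed

context pair_graph
begin

lemma graph_iso_complete_graph_iff:
  assumes "card (pverts G) = n"
  shows "graph_iso G (complete_graph n) \<longleftrightarrow>
    (\<forall>u\<in>pverts G. \<forall>v\<in>pverts G. (u, v) \<in> parcs G \<longleftrightarrow> u \<noteq> v)" (is "_ \<longleftrightarrow> ?complete")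
proof -
  have iso: "graph_iso G (complete_graph n) \<longleftrightarrow> (\<exists>f. bij_betw f (pverts G) {..<n} \<and>
      (\<forall>u\<in>pverts G. \<forall>v\<in>pverts G. (u, v) \<in> parcs G \<longleftrightarrow> f u < n \<and> f v < n \<and> f u \<noteq> f v))"
    by (subst graph_iso_iff[OF pair_graph pair_graph_complete_graph])
      (simp add: complete_graph_def)
  have arc: "f u < n \<and> f v < n \<and> f u \<noteq> f v \<longleftrightarrow> u \<noteq> v"
    if "bij_betw f (pverts G) {..<n}" "u \<in> pverts G" "v \<in> pverts G" for f u v
    using that by (auto simp: bij_betw_def inj_on_eq_iff)
  obtain f where f: "bij_betw f (pverts G) {..<n}"
    using assms pair_finite_verts by (metis card_lessThan finite_lessThan finite_same_card_bij)
  show ?thesis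
  proof
    assume "graph_iso G (complete_graph n)"
    then show ?complete unfolding iso using arc by blast
  next
    assume ?complete
    then show "graph_iso G (complete_graph n)" unfolding iso using f arc[OF f] by blast
  qed
qed

lemma graph_iso_star_graph_iff:
  assumes "card (pverts G) = n" "n \<ge> 2"
  shows "graph_iso G (star_graph n) \<longleftrightarrow>
    (\<exists>c\<in>pverts G. \<forall>u\<in>pverts G. \<forall>v\<in>pverts G. (u, v) \<in> parcs G \<longleftrightarrow> u \<noteq> v \<and> (u = c \<or> v = c))"
    (is "_ \<longleftrightarrow> (\<exists>c\<in>_. ?star c)")
proof -
  have iso: "graph_iso G (star_graph n) \<longleftrightarrow> (\<exists>f. bij_betw f (pverts G) {..<n} \<and>
      (\<forall>u\<in>pverts G. \<forall>v\<in>pverts G. (u, v) \<in> parcs G \<longleftrightarrow> (f u, f v) \<in> parcs (star_graph n)))"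
    by (subst graph_iso_iff[OF pair_graph pair_graph_star_graph]) (simp add: star_graph_def)
  have arc: "(f u, f v) \<in> parcs (star_graph n) \<longleftrightarrow> u \<noteq> v \<and> (u = c \<or> v = c)"
    if f: "bij_betw f (pverts G) {..<n}" "u \<in> pverts G" "v \<in> pverts G" "c \<in> pverts G" "f c = 0"
    for f u v c
  proof -
    have "(f u, f v) \<in> parcs (star_graph n) \<longleftrightarrow> f u \<noteq> f v \<and> (f u = f c \<or> f v = f c)"
      using f by (auto simp: star_graph_def bij_betw_def)
    moreover have "f p = f q \<longleftrightarrow> p = q" if "p \<in> pverts G" "q \<in> pverts G" for p q
      using inj_on_eq_iff[OF bij_betw_imp_inj_on[OF f(1)] that] .
    ultimately show ?thesis using f by metis
  qed
  show ?thesis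
  proof
    assume "graph_iso G (star_graph n)"
    then obtain f where f: "bij_betw f (pverts G) {..<n}"
      "\<forall>u\<in>pverts G. \<forall>v\<in>pverts G. (u, v) \<in> parcs G \<longleftrightarrow> (f u, f v) \<in> parcs (star_graph n)"
      unfolding iso by blast
    have "0 \<in> f ` pverts G" using f(1) assms(2) by (simp add: bij_betw_def)
    then obtain c where "c \<in> pverts G" "f c = 0" by auto
    then show "\<exists>c\<in>pverts G. ?star c" using f arc by blast
  next
    assume "\<exists>c\<in>pverts G. ?star c"
    then obtain c where c: "c \<in> pverts G" "?star c" by blast
    then obtain b where b: "b \<in> pverts G" "b \<noteq> c"
      using assms by (metis card_le_Suc0_iff_eq not_less_eq_eq numeral_2_eq_2 pair_finite_verts)
    have n: "0 < n" "1 < n" "0 \<noteq> (1::nat)" using assms(2) by auto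
    obtain f where f: "bij_betw f (pverts G) {..<n}" "f c = 0"
      using bij_betw_two_prescribed[OF pair_finite_verts assms(1) c(1) b(1) b(2)[symmetric] n]
      by blast
    then show "graph_iso G (star_graph n)"
      unfolding iso using f(1) c(2) by (intro exI[of _ f]) (simp add: arc[OF f(1) _ _ c(1) f(2)])
  qed
qed

lemma graph_iso_complete_graph_plus_leaf_iff:
  assumes "card (pverts G) = n" "n \<ge> 2"
  shows "graph_iso G (complete_graph_plus_leaf (n - 1)) \<longleftrightarrow>
    (\<exists>c\<in>pverts G. \<exists>w\<in>pverts G. c \<noteq> w \<and> (\<forall>u\<in>pverts G. \<forall>v\<in>pverts G.
      (u, v) \<in> parcs G \<longleftrightarrow> u \<noteq> v \<and> (u = w \<longrightarrow> v = c) \<and> (v = w \<longrightarrow> u = c)))"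
    (is "_ \<longleftrightarrow> (\<exists>c\<in>_. \<exists>w\<in>_. ?plus c w)")
proof -
  let ?H = "complete_graph_plus_leaf (n - 1)"
  have "pair_graph ?H" using assms(2) by (intro pair_graph_complete_graph_plus_leaf) simp
  moreover have verts: "pverts ?H = {..<n}"
    using assms(2) by (auto simp: complete_graph_plus_leaf_def complete_graph_def)
  ultimately have iso: "graph_iso G ?H \<longleftrightarrow> (\<exists>f. bij_betw f (pverts G) {..<n} \<and>
      (\<forall>u\<in>pverts G. \<forall>v\<in>pverts G. (u, v) \<in> parcs G \<longleftrightarrow> (f u, f v) \<in> parcs ?H))"
    by (simp add: graph_iso_iff[OF pair_graph])
  have arc: "(f u, f v) \<in> parcs ?H \<longleftrightarrow> u \<noteq> v \<and> (u = w \<longrightarrow> v = c) \<and> (v = w \<longrightarrow> u = c)"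
    if f: "bij_betw f (pverts G) {..<n}" "u \<in> pverts G" "v \<in> pverts G"
      "c \<in> pverts G" "f c = 0" "w \<in> pverts G" "f w = n - 1" for f u v c w
  proof -
    have "f u < n" "f v < n" using f by (auto simp: bij_betw_def)
    then have "(f u, f v) \<in> parcs ?H \<longleftrightarrow>
        f u \<noteq> f v \<and> (f u = f w \<longrightarrow> f v = f c) \<and> (f v = f w \<longrightarrow> f u = f c)"
      using f assms(2) by (auto simp: complete_graph_plus_leaf_def complete_graph_def)
    moreover have "f p = f q \<longleftrightarrow> p = q" if "p \<in> pverts G" "q \<in> pverts G" for p q
      using inj_on_eq_iff[OF bij_betw_imp_inj_on[OF f(1)] that] .
    ultimately show ?thesis using f by metis
  qed
  show ?thesis
  proof
    assume "graph_iso G ?H"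
    then obtain f where f: "bij_betw f (pverts G) {..<n}"
      "\<forall>u\<in>pverts G. \<forall>v\<in>pverts G. (u, v) \<in> parcs G \<longleftrightarrow> (f u, f v) \<in> parcs ?H"
      unfolding iso by blast
    have "0 \<in> f ` pverts G" "n - 1 \<in> f ` pverts G"
      using f(1) assms(2) by (simp_all add: bij_betw_def)
    then obtain c w where cw: "c \<in> pverts G" "f c = 0" "w \<in> pverts G" "f w = n - 1" by force
    then have "c \<noteq> w" using assms(2) by auto
    then have "?plus c w" using arc[OF f(1) _ _ cw] f(2) by blast
    then show "\<exists>c\<in>pverts G. \<exists>w\<in>pverts G. ?plus c w" using cw by blast
  next
    assume "\<exists>c\<in>pverts G. \<exists>w\<in>pverts G. ?plus c w"
    then obtain c w where cw: "c \<in> pverts G" "w \<in> pverts G" "?plus c w" by blast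
    then obtain f where f: "bij_betw f (pverts G) {..<n}" "f c = 0" "f w = n - 1"
      using bij_betw_two_prescribed[of "pverts G" n c w 0 "n - 1"] assms pair_finite_verts by auto
    then show "graph_iso G ?H"
      unfolding iso using f(1) cw(3)
      by (intro exI[of _ f]) (simp add: arc[OF f(1) _ _ cw(1) f(2) cw(2) f(3)] del: One_nat_def)
  qed
qed

lemma graph_iso_complete_graph_minus_edge_iff:
  assumes "card (pverts G) = n" "n \<ge> 2"
  shows "graph_iso G (complete_graph_minus_edge n) \<longleftrightarrow>
    (\<exists>a\<in>pverts G. \<exists>b\<in>pverts G. a \<noteq> b \<and> (\<forall>u\<in>pverts G. \<forall>v\<in>pverts G.
      (u, v) \<in> parcs G \<longleftrightarrow> u \<noteq> v \<and> \<not> (u = a \<and> v = b) \<and> \<not> (u = b \<and> v = a)))"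
    (is "_ \<longleftrightarrow> (\<exists>a\<in>_. \<exists>b\<in>_. ?minus a b)")
proof -
  let ?H = "complete_graph_minus_edge n"
  have iso: "graph_iso G ?H \<longleftrightarrow> (\<exists>f. bij_betw f (pverts G) {..<n} \<and>
      (\<forall>u\<in>pverts G. \<forall>v\<in>pverts G. (u, v) \<in> parcs G \<longleftrightarrow> (f u, f v) \<in> parcs ?H))"
    by (subst graph_iso_iff[OF pair_graph pair_graph_complete_graph_minus_edge])
      (simp add: complete_graph_minus_edge_def complete_graph_def)
  have arc: "(f u, f v) \<in> parcs ?H \<longleftrightarrow> u \<noteq> v \<and> \<not> (u = a \<and> v = b) \<and> \<not> (u = b \<and> v = a)"
    if f: "bij_betw f (pverts G) {..<n}" "u \<in> pverts G" "v \<in> pverts G"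
      "a \<in> pverts G" "f a = 0" "b \<in> pverts G" "f b = 1" for f u v a b
  proof -
    have "f u < n" "f v < n" using f by (auto simp: bij_betw_def)
    then have "(f u, f v) \<in> parcs ?H \<longleftrightarrow>
        f u \<noteq> f v \<and> \<not> (f u = f a \<and> f v = f b) \<and> \<not> (f u = f b \<and> f v = f a)"
      using f by (auto simp: complete_graph_minus_edge_def complete_graph_def)
    moreover have "f p = f q \<longleftrightarrow> p = q" if "p \<in> pverts G" "q \<in> pverts G" for p q
      using inj_on_eq_iff[OF bij_betw_imp_inj_on[OF f(1)] that] .
    ultimately show ?thesis using f by metis
  qed
  show ?thesis
  proof
    assume "graph_iso G ?H"
    then obtain f where f: "bij_betw f (pverts G) {..<n}"
      "\<forall>u\<in>pverts G. \<forall>v\<in>pverts G. (u, v) \<in> parcs G \<longleftrightarrow> (f u, f v) \<in> parcs ?H"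
      unfolding iso by blast
    have "0 \<in> f ` pverts G" "1 \<in> f ` pverts G"
      using f(1) assms(2) by (simp_all add: bij_betw_def)
    then obtain a b where ab: "a \<in> pverts G" "f a = 0" "b \<in> pverts G" "f b = 1" by force
    then have "a \<noteq> b" by auto
    then have "?minus a b" using arc[OF f(1) _ _ ab] f(2) by blast
    then show "\<exists>a\<in>pverts G. \<exists>b\<in>pverts G. ?minus a b" using ab by blast
  next
    assume "\<exists>a\<in>pverts G. \<exists>b\<in>pverts G. ?minus a b"
    then obtain a b where ab: "a \<in> pverts G" "b \<in> pverts G" "?minus a b" by blast
    then obtain f where f: "bij_betw f (pverts G) {..<n}" "f a = 0" "f b = 1"
      using bij_betw_two_prescribed[of "pverts G" n a b 0 1] assms pair_finite_verts by auto
    then show "graph_iso G ?H"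
      unfolding iso using f(1) ab(3)
      by (intro exI[of _ f]) (simp add: arc[OF f(1) _ _ ab(1) f(2) ab(2) f(3)])
  qed
qed

section \<open>Connected graphs whose nonpendant vertices are near twins\<close>

lemma connected_closed_set:
  assumes "Digraph_Component.connected (with_proj G)" "x \<in> pverts G" "x \<in> T"
    and closed: "\<And>u v. u \<in> T \<Longrightarrow> v \<in> nbrs u \<Longrightarrow> v \<in> T"
  shows "pverts G \<subseteq> T"
proof
  fix y assume "y \<in> pverts G"
  then have "x \<rightarrow>\<^sup>*\<^bsub>with_proj G\<^esub> y"
    using symmetric_connected_imp_strongly_connected[OF pair_sym_arcs assms(1)] assms(2)
    by (simp add: strongly_connected_def)
  then show "y \<in> T"
    by (induction rule: reachable_induct) (use assms(3) closed in \<open>auto simp: nbrs_def\<close>)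
qed

text \<open>
  If the neighbour were pendant as well, the two vertices would form a component; a vertex without
  neighbours would be a component by itself.
\<close>

lemma pendant_nbr_nonpendant:
  assumes con: "Digraph_Component.connected (with_proj G)" and card: "card (pverts G) \<ge> 3"
    and v: "v \<in> pverts G" "\<not> nonpendant v"
  obtains c where "nbrs v = {c}" "nonpendant c"
proof -
  from v(2) obtain c where c: "nbrs v \<subseteq> {c}" by (auto simp: nonpendant_def)
  have large: "\<not> pverts G \<subseteq> {v, w}" for w
  proof
    assume "pverts G \<subseteq> {v, w}"
    then have "card (pverts G) \<le> card {v, w}" by (rule card_mono[rotated]) simp
    also have "\<dots> \<le> 2" by (simp add: card_insert_if)
    finally show False using card by linarith
  qed
  have "nbrs v \<noteq> {}"
  proof
    assume "nbrs v = {}"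
    then have "pverts G \<subseteq> {v}" using v(1) by (intro connected_closed_set[OF con, of v]) auto
    then show False using large[of v] by simp
  qed
  with c have nv: "nbrs v = {c}" by blast
  moreover have "nonpendant c"
  proof (rule ccontr)
    assume "\<not> nonpendant c"
    moreover have "v \<in> nbrs c" using nv nbrs_sym by blast
    ultimately have "nbrs c \<subseteq> {v}" by (auto simp: nonpendant_def)
    then have "pverts G \<subseteq> {v, c}"
      using v(1) nv by (intro connected_closed_set[OF con, of v]) auto
    then show False using large by blast
  qed
  ultimately show thesis by (rule that)
qed

lemma nonpendantI: "a \<in> nbrs v \<Longrightarrow> b \<in> nbrs v \<Longrightarrow> a \<noteq> b \<Longrightarrow> nonpendant v"
  by (auto simp: nonpendant_def)

lemma near_twins_unique:
  assumes "near_twins x y" "z \<noteq> x" "z \<noteq> y" "(z \<in> nbrs x) \<noteq> (z \<in> nbrs y)"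
    "z' \<noteq> x" "z' \<noteq> y" "(z' \<in> nbrs x) \<noteq> (z' \<in> nbrs y)"
  shows "z = z'"
  using assms unfolding near_twins_def by metis

text \<open>
  The vertices adjacent to both \<open>a\<close> and \<open>c\<close> are near twins of both, which uses up the one
  exception that near twins may have. Hence any other vertex is adjacent to all or none of \<open>a\<close>,
  \<open>c\<close> and their common neighbours, and by connectedness each is a common neighbour.
\<close>

lemma induced_path_imp_complete_minus_edge:
  assumes con: "Digraph_Component.connected (with_proj G)"
    and twins: "\<And>x y. x \<in> pverts G \<Longrightarrow> y \<in> pverts G \<Longrightarrow> x \<noteq> y \<Longrightarrow>
      nonpendant x \<Longrightarrow> nonpendant y \<Longrightarrow> near_twins x y"
    and ac: "a \<in> pverts G" "c \<in> pverts G" "a \<noteq> c" "nonpendant a" "nonpendant c" "c \<notin> nbrs a"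
    and b: "b \<in> nbrs a" "b \<in> nbrs c"
    and uv: "u \<in> pverts G" "v \<in> pverts G"
  shows "v \<in> nbrs u \<longleftrightarrow> u \<noteq> v \<and> \<not> (u = a \<and> v = c) \<and> \<not> (u = c \<and> v = a)"
proof -
  \<comment> \<open>\<open>c\<close> already distinguishes \<open>a\<close> from \<open>m\<close>, and \<open>a\<close> distinguishes \<open>c\<close> from \<open>m\<close>.\<close>
  have same: "z \<in> nbrs m \<longleftrightarrow> z \<in> nbrs a" "z \<in> nbrs m \<longleftrightarrow> z \<in> nbrs c"
    if m: "m \<in> nbrs a" "m \<in> nbrs c" and z: "z \<noteq> a" "z \<noteq> c" "z \<noteq> m" for m z
  proof -
    have am: "a \<in> nbrs m" "c \<in> nbrs m" using m nbrs_sym by blast+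
    have m_props: "m \<in> pverts G" "nonpendant m" "m \<noteq> a" "m \<noteq> c"
      using am ac(3) m nbrs_subset nonpendantI by auto
    have ca: "a \<notin> nbrs c" using ac(6) nbrs_sym by blast
    have "near_twins a m" "near_twins c m" using twins m_props ac by blast+
    then show "z \<in> nbrs m \<longleftrightarrow> z \<in> nbrs a" "z \<in> nbrs m \<longleftrightarrow> z \<in> nbrs c"
      using near_twins_unique[of a m z c] near_twins_unique[of c m z a] z am ca ac(3,6) m_props(3,4)
      by metis+
  qed
  let ?T = "{z. z = a \<or> z = c \<or> (z \<in> nbrs a \<and> z \<in> nbrs c)}"
  have "pverts G \<subseteq> ?T"
  proof (rule connected_closed_set[OF con ac(1)])
    fix s t assume s: "s \<in> ?T" and t: "t \<in> nbrs s"
    show "t \<in> ?T"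
    proof (cases "t = a \<or> t = c \<or> t = b")
      case True
      then show ?thesis using b by blast
    next
      case False
      then have "t \<in> nbrs a \<longleftrightarrow> t \<in> nbrs c" using same[OF b, of t] by blast
      moreover have "t \<in> nbrs a \<or> t \<in> nbrs c"
        using s t False same[of s t] by (cases "s = t") auto
      ultimately show ?thesis by blast
    qed
  qed simp
  then have uT: "u \<in> ?T" and vT: "v \<in> ?T" using uv by blast+
  show ?thesis
  proof (cases "u = a \<or> u = c \<or> v = a \<or> v = c")
    case True
    then show ?thesis using uT vT ac(3,6) nbrs_sym[of c a] nbrs_sym[of u a] nbrs_sym[of u c] by auto
  next
    case False
    then show ?thesis using uT vT same[of u v] by auto
  qed
qed

text \<open>
  If no two nonpendant vertices are at distance two, the nonpendant vertices of a walk from \<open>a\<close>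
  never leave the closed neighbourhood of \<open>a\<close>. The pendant vertices of the walk may be one
  step further away, but the walk must return from there by the edge it came.
\<close>

lemma nonpendant_vertices_adjacent:
  assumes con: "Digraph_Component.connected (with_proj G)" and card: "card (pverts G) \<ge> 3"
    and no_path: "\<And>x m y. x \<noteq> y \<Longrightarrow> nonpendant x \<Longrightarrow> nonpendant y \<Longrightarrow>
      m \<in> nbrs x \<Longrightarrow> m \<in> nbrs y \<Longrightarrow> y \<in> nbrs x"
    and ac: "a \<in> pverts G" "c \<in> pverts G" "a \<noteq> c" "nonpendant a" "nonpendant c"
  shows "c \<in> nbrs a"
proof -
  let ?T = "{w. w = a \<or> w \<in> nbrs a \<or> (\<not> nonpendant w \<and> (\<exists>m\<in>insert a (nbrs a). m \<in> nbrs w))}"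
  have "pverts G \<subseteq> ?T"
  proof (rule connected_closed_set[OF con ac(1)])
    fix s t assume s: "s \<in> ?T" and t: "t \<in> nbrs s"
    have st: "s \<in> nbrs t" using t nbrs_sym by blast
    show "t \<in> ?T"
    proof (cases "s \<in> insert a (nbrs a)")
      case True
      then show ?thesis using t st no_path[of a t s] ac(4) by auto
    next
      case False
      then obtain m where "\<not> nonpendant s" "m \<in> insert a (nbrs a)" "m \<in> nbrs s" using s by blast
      then have "t = m" using t nonpendantI by blast
      then show ?thesis using \<open>m \<in> insert a (nbrs a)\<close> by blast
    qed
  qed simp
  then show ?thesis using ac by blast
qed

text \<open>
  The cases are an induced path with nonpendant ends, which gives \<open>K\<^sub>n - e\<close>, and otherwise a
  clique of nonpendant vertices: a single vertex gives the star, and a larger clique carries no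
  leaf or one leaf.
\<close>

lemma near_twins_imp_extremal:
  assumes con: "Digraph_Component.connected (with_proj G)"
    and card: "card (pverts G) = n" "n \<ge> 3"
    and twins: "\<And>x y. x \<in> pverts G \<Longrightarrow> y \<in> pverts G \<Longrightarrow> x \<noteq> y \<Longrightarrow>
      nonpendant x \<Longrightarrow> nonpendant y \<Longrightarrow> near_twins x y"
  shows "graph_iso G (complete_graph n) \<or> graph_iso G (star_graph n) \<or>
    graph_iso G (complete_graph_plus_leaf (n - 1)) \<or> graph_iso G (complete_graph_minus_edge n)"
proof (cases "\<exists>x m y. x \<noteq> y \<and> nonpendant x \<and> nonpendant y \<and> m \<in> nbrs x \<and> m \<in> nbrs y \<and> y \<notin> nbrs x")
  case True
  then obtain x m y where xmy: "x \<noteq> y" "nonpendant x" "nonpendant y" "m \<in> nbrs x" "m \<in> nbrs y"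
    "y \<notin> nbrs x" by blast
  then have "x \<in> pverts G" "y \<in> pverts G" using nbrs_sym nbrs_subset by blast+
  moreover from this have "\<forall>u\<in>pverts G. \<forall>v\<in>pverts G.
      (u, v) \<in> parcs G \<longleftrightarrow> u \<noteq> v \<and> \<not> (u = x \<and> v = y) \<and> \<not> (u = y \<and> v = x)"
    using induced_path_imp_complete_minus_edge[OF con twins _ _ xmy(1-3,6,4,5)]
    by (simp add: nbrs_def)
  moreover have "n \<ge> 2" using card(2) by simp
  ultimately have "graph_iso G (complete_graph_minus_edge n)"
    using graph_iso_complete_graph_minus_edge_iff[OF card(1)] xmy(1) by blast
  then show ?thesis by blast
next
  case False
  note card3 = card(2)[folded card(1)]
  have pendant: "\<exists>c. nbrs v = {c} \<and> nonpendant c" if "v \<in> pverts G" "\<not> nonpendant v" for v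
    using pendant_nbr_nonpendant[OF con card3 that] by metis
  have adjacent: "y \<in> nbrs x"
    if "x \<in> pverts G" "y \<in> pverts G" "x \<noteq> y" "nonpendant x" "nonpendant y" for x y
    using nonpendant_vertices_adjacent[OF con card3 _ that] False by blast
  have "pverts G \<noteq> {}" using card by auto
  then obtain v0 where "v0 \<in> pverts G" by blast
  then obtain c where c: "c \<in> pverts G" "nonpendant c"
    using pendant[of v0] nbrs_subset by blast
  show ?thesis
  proof (cases "\<exists>d\<in>pverts G. d \<noteq> c \<and> nonpendant d")
    case False
    have nbrs_leaf: "nbrs v = {c}" if "v \<in> pverts G" "v \<noteq> c" for v
      using pendant[of v] False that nbrs_subset by (metis insert_subset)
    have "v \<in> nbrs u \<longleftrightarrow> u \<noteq> v \<and> (u = c \<or> v = c)" if "u \<in> pverts G" "v \<in> pverts G" for u v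
      using nbrs_leaf[of u] nbrs_leaf[of v] that nbrs_sym[of v u] by (cases "u = c") auto
    then have "graph_iso G (star_graph n)"
      using c(1) graph_iso_star_graph_iff[OF card(1)] card(2) by (auto simp: nbrs_def)
    then show ?thesis by blast
  next
    case True
    \<comment> \<open>
      A leaf at \<open>x\<close> distinguishes \<open>x\<close> from any other nonpendant vertex \<open>y\<close>, and so does a leaf at \<open>y\<close>.
      For leaves at different vertices \<open>x\<close>, \<open>x'\<close> the pair to compare is \<open>x\<close>, \<open>x'\<close>.
    \<close>
    have one_leaf: "v = w"
      if v: "v \<in> pverts G" "\<not> nonpendant v" and w: "w \<in> pverts G" "\<not> nonpendant w" for v w
    proof -
      obtain x where x: "nbrs v = {x}" "nonpendant x" using pendant v by blast
      obtain x' where x': "nbrs w = {x'}" "nonpendant x'" using pendant w by blast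
      have x_vert: "x \<in> pverts G" "x' \<in> pverts G" using x(1) x'(1) nbrs_subset by blast+
      obtain y where y: "y \<in> pverts G" "nonpendant y" "y \<noteq> x" "x' \<in> {x, y}"
        using True c x'(2) x_vert(2) by (cases "x' = x"; cases "x = c") auto
      have "near_twins x y" using twins y x x_vert by blast
      moreover have "v \<noteq> x" "v \<noteq> y" "w \<noteq> x" "w \<noteq> y" using v w x y by auto
      moreover have "(v \<in> nbrs x) \<noteq> (v \<in> nbrs y)" "(w \<in> nbrs x) \<noteq> (w \<in> nbrs y)"
        using x(1) x'(1) y(3,4) nbrs_sym[of v] nbrs_sym[of w] by auto
      ultimately show "v = w" using near_twins_unique by blast
    qed
    show ?thesis
    proof (cases "\<forall>v\<in>pverts G. nonpendant v")
      case True
      then have "graph_iso G (complete_graph n)"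
        using adjacent graph_iso_complete_graph_iff[OF card(1)] nbrs_irrefl
        by (auto simp: nbrs_def)
      then show ?thesis by blast
    next
      case False
      then obtain w where w: "w \<in> pverts G" "\<not> nonpendant w" by blast
      then obtain x where x: "nbrs w = {x}" "nonpendant x" using pendant by blast
      have x_vert: "x \<in> pverts G" "x \<noteq> w" using x w nbrs_subset by auto
      have "v \<in> nbrs u \<longleftrightarrow> u \<noteq> v \<and> (u = w \<longrightarrow> v = x) \<and> (v = w \<longrightarrow> u = x)"
        if uv: "u \<in> pverts G" "v \<in> pverts G" for u v
      proof (cases "u = w \<or> v = w")
        case True
        then show ?thesis using x(1) x_vert(2) nbrs_sym[of v u] by auto
      next
        case False
        then have "nonpendant u" "nonpendant v" using one_leaf w uv by blast+
        then show ?thesis using False adjacent[of u v] uv by auto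
      qed
      then have "graph_iso G (complete_graph_plus_leaf (n - 1))"
        using w(1) x_vert graph_iso_complete_graph_plus_leaf_iff[OF card(1)] card(2)
        by (auto simp: nbrs_def)
      then show ?thesis by blast
    qed
  qed
qed

lemma near_twinsI:
  assumes "\<And>z. z \<in> pverts G \<Longrightarrow> z \<noteq> x \<Longrightarrow> z \<noteq> y \<Longrightarrow>
    ((x, z) \<in> parcs G) \<noteq> ((y, z) \<in> parcs G) \<Longrightarrow> z = l"
  shows "near_twins x y"
  unfolding near_twins_def nbrs_def using assms in_arcsD2 by blast

lemma extremal_imp_near_twins:
  assumes card: "card (pverts G) = n" "n \<ge> 3"
    and iso: "graph_iso G (complete_graph n) \<or> graph_iso G (star_graph n) \<or>
      graph_iso G (complete_graph_plus_leaf (n - 1)) \<or> graph_iso G (complete_graph_minus_edge n)"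
    and xy: "x \<in> pverts G" "y \<in> pverts G" "x \<noteq> y" "nonpendant x" "nonpendant y"
  shows "near_twins x y"
proof -
  from card(2) have n2: "n \<ge> 2" by simp
  \<comment> \<open>
    In \<open>K\<^sub>n\<close> no vertex distinguishes \<open>x\<close> from \<open>y\<close>, and a star has only one nonpendant vertex. With an
    added leaf only the leaf can distinguish, and without the edge \<open>ab\<close> only
    the nonneighbour of whichever of \<open>a\<close>, \<open>b\<close> is in the pair.
  \<close>
  note iffs = graph_iso_complete_graph_iff[OF card(1)] graph_iso_star_graph_iff[OF card(1) n2]
    graph_iso_complete_graph_plus_leaf_iff[OF card(1) n2]
    graph_iso_complete_graph_minus_edge_iff[OF card(1) n2]
  from iso show ?thesis unfolding iffs
  proof (elim disjE bexE conjE)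
    assume "\<forall>u\<in>pverts G. \<forall>v\<in>pverts G. (u, v) \<in> parcs G \<longleftrightarrow> u \<noteq> v"
    then show ?thesis using xy by (intro near_twinsI) auto
  next
    fix c assume star: "c \<in> pverts G"
      "\<forall>u\<in>pverts G. \<forall>v\<in>pverts G. (u, v) \<in> parcs G \<longleftrightarrow> u \<noteq> v \<and> (u = c \<or> v = c)"
    have "v = c" if v: "v \<in> pverts G" "nonpendant v" for v
    proof (rule ccontr)
      assume "v \<noteq> c"
      then have "nbrs v \<subseteq> {c}" using star(2) v(1) by (auto simp: nbrs_def dest: in_arcsD2)
      then show False using v(2) by (auto simp: nonpendant_def)
    qed
    then show ?thesis using xy by blast
  next
    fix c w assume plus: "c \<in> pverts G" "w \<in> pverts G" "c \<noteq> w"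
      "\<forall>u\<in>pverts G. \<forall>v\<in>pverts G.
        (u, v) \<in> parcs G \<longleftrightarrow> u \<noteq> v \<and> (u = w \<longrightarrow> v = c) \<and> (v = w \<longrightarrow> u = c)"
    have "nbrs w \<subseteq> {c}" using plus(2,4) by (auto simp: nbrs_def dest: in_arcsD2)
    then have "x \<noteq> w" "y \<noteq> w" using xy by (auto simp: nonpendant_def)
    then show ?thesis using xy plus(4) by (intro near_twinsI[of _ _ w]) auto
  next
    fix a b assume minus: "a \<in> pverts G" "b \<in> pverts G" "a \<noteq> b"
      "\<forall>u\<in>pverts G. \<forall>v\<in>pverts G.
        (u, v) \<in> parcs G \<longleftrightarrow> u \<noteq> v \<and> \<not> (u = a \<and> v = b) \<and> \<not> (u = b \<and> v = a)"
    show ?thesis using xy minus(4) by (intro near_twinsI[of _ _ "if x = a \<or> y = a then b else a"]) auto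
  qed
qed

end

theorem theorem6p4:
  fixes G :: "'a pair_pre_digraph" and n :: nat
  assumes "pair_graph G"
    and "Digraph_Component.connected (with_proj G)"
    and "card (pverts G) = n"
    and "n \<ge> 3"
  shows "leaky_forcing_number 1 G = n - 1 \<longleftrightarrow>
      graph_iso G (complete_graph n) \<or>
      graph_iso G (star_graph n) \<or>
      graph_iso G (complete_graph_plus_leaf (n - 1)) \<or>
      graph_iso G (complete_graph_minus_edge n)"
proof -
  interpret pair_graph G by fact
  have "pverts G \<noteq> {}" using assms(3,4) by auto
  then obtain v where v: "v \<in> pverts G" by blast
  obtain u where u: "u \<in> pverts G" "nonpendant u"
  proof (cases "nonpendant v")
    case True
    then show thesis using v that by blast
  next
    case False
    then obtain c where "nbrs v = {c}" "nonpendant c"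
      using pendant_nbr_nonpendant[OF assms(2) _ v] assms(3,4) by blast
    then show thesis using that nbrs_subset by blast
  qed
  have "leaky_forcing_number 1 G = n - 1 \<longleftrightarrow>
    (\<forall>x\<in>pverts G. \<forall>y\<in>pverts G. x \<noteq> y \<and> nonpendant x \<and> nonpendant y \<longrightarrow> near_twins x y)"
    using assms(3,4) u by (intro leaky_forcing_number_one_eq_iff) auto
  then show ?thesis
    using near_twins_imp_extremal[OF assms(2-4)] extremal_imp_near_twins[OF assms(3,4)] by blast
qed

end
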